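(* Let $G$ be a finite simple graph, and let $G_1$ and $G_2$ form a splitting of $G$ along an induced subgraph $H\subseteq G$ isomorphic to a path graph $P_l$ ($l\geq 1$ edges), such that every vertex of $H$ distinct from the two endpoints of $H$ has degree $2$ when considered as a vertex of $G$. If $G_1$ is bipartite, then $$I_G=(I_{G_1}+I_{G_2}):f^\infty,$$ where $f$ denotes the square-free monomial given by the product of the edges of $H$ with even indices.
   Context: $\mathbb{K}$ is an algebraically closed field of characteristic zero. For a finite simple graph $G$ with vertices $V(G)=\{x_1,\ldots,x_n\}$ and edges $E(G)=\{e_1,\ldots,e_q\}$, the toric ideal $I_G$ is the kernel of the $\mathbb{K}$-algebra homomorphism $\mathbb{K}[E(G)]=\mathbb{K}[e_1,\ldots,e_q]\to\mathbb{K}[x_1,\ldots,x_n]$ sending $e_i=\{x_{i,1},x_{i,2}\}$ to $x_{i,1}x_{i,2}$. For a subgraph $G_i$ of $G$, $I_{G_i}$ is viewed as an ideal of $\mathbb{K}[E(G)]$ (by extension). Splitting: let $W_1,W_2\subseteq V(G)$ with $W_1\cup W_2=V(G)$, let $G_i$ be the induced subgraph of $G$ on $W_i$, let $Y=W_1\cap W_2$ and let $H$ be the induced subgraph on $Y$. Then $G_1$ and $G_2$ form a splitting of $G$ along $H$ if removing the vertices $Y$ from $G$ yields two disconnected pieces, i.e. no edge of $G$ joins a vertex of $W_1\setminus Y$ to a vertex of $W_2\setminus Y$. The path graph $P_l$ has vertices $x_1,\ldots,x_{l+1}$ and edges $\{x_1,x_2\},\ldots,\{x_l,x_{l+1}\}$.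 The edges of $H$ are labelled $h_1,\ldots,h_l$ consecutively along the path (starting at one of its endpoints), and $f=\prod_{2\mid k}h_k$ (so $f=1$ if $l=1$). For an ideal $I$, $I:f^\infty=\{g : f^m g\in I\text{ for some }m\ge 0\}$. *)

theory Defs
  imports
    "HOL-Library.Poly_Mapping"
    "HOL-Computational_Algebra.Polynomial"
    "HOL-Algebra.Ideal"
begin

section \<open>Finite simple graphs\<close>

record 'v graph =
  verts :: "'v set"
  edges :: "'v set set"

definition finite_simple_graph :: "'v graph \<Rightarrow> bool" where
  "finite_simple_graph G \<longleftrightarrow>
     finite (verts G) \<and> edges G \<subseteq> {{u, v} | u v. u \<in> verts G \<and> v \<in> verts G \<and> u \<noteq> v}"

definition induced_subgraph :: "'v graph \<Rightarrow> 'v set \<Rightarrow> 'v graph" where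
  "induced_subgraph G W = \<lparr>verts = W, edges = {e \<in> edges G. e \<subseteq> W}\<rparr>"

definition vertex_degree :: "'v graph \<Rightarrow> 'v \<Rightarrow> nat" where
  "vertex_degree G v = card {e \<in> edges G. v \<in> e}"

definition bipartite :: "'v graph \<Rightarrow> bool" where
  "bipartite G \<longleftrightarrow>
     (\<exists>A B. A \<union> B = verts G \<and> A \<inter> B = {} \<and> (\<forall>e \<in> edges G. \<exists>a \<in> A. \<exists>b \<in> B. e = {a, b}))"

definition graph_iso :: "'u graph \<Rightarrow> 'v graph \<Rightarrow> ('u \<Rightarrow> 'v) \<Rightarrow> bool" where
  "graph_iso G H \<phi> \<longleftrightarrow>
     bij_betw \<phi> (verts G) (verts H) \<and>
     (\<forall>u \<in> verts G. \<forall>v \<in> verts G. {u, v} \<in> edges G \<longleftrightarrow> {\<phi> u, \<phi> v} \<in> edges H)"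

text \<open>The path with \<open>l\<close> edges, on the vertices \<open>1, \<dots>, l + 1\<close>.\<close>

definition path_graph :: "nat \<Rightarrow> nat graph" where
  "path_graph l = \<lparr>verts = {1..l + 1}, edges = {{k, k + 1} | k. k \<in> {1..l}}\<rparr>"

definition splitting_along :: "'v graph \<Rightarrow> 'v graph \<Rightarrow> 'v graph \<Rightarrow> 'v graph \<Rightarrow> bool" where
  "splitting_along G G1 G2 H \<longleftrightarrow>
     (\<exists>W1 W2. W1 \<union> W2 = verts G \<and>
        G1 = induced_subgraph G W1 \<and> G2 = induced_subgraph G W2 \<and>
        H = induced_subgraph G (W1 \<inter> W2) \<and>
        (\<forall>u \<in> W1 - (W1 \<inter> W2). \<forall>v \<in> W2 - (W1 \<inter> W2). {u, v} \<notin> edges G))"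


section \<open>Polynomial rings\<close>

text \<open>
  A polynomial maps exponent vectors to coefficients.  The type provides variables for all
  elements of \<open>'x\<close>; the ring of polynomials in a set \<open>X\<close> of variables is cut out
  as a carrier set.
\<close>

type_synonym ('x, 'k) mpoly = "('x \<Rightarrow>\<^sub>0 nat) \<Rightarrow>\<^sub>0 'k"

definition mconst :: "'k \<Rightarrow> ('x, 'k::comm_ring_1) mpoly" where
  "mconst c = Poly_Mapping.single 0 c"

definition mvar :: "'x \<Rightarrow> ('x, 'k::comm_ring_1) mpoly" where
  "mvar x = Poly_Mapping.single (Poly_Mapping.single x 1) 1"

definition poly_ring :: "'x set \<Rightarrow> ('x, 'k::comm_ring_1) mpoly ring" where
  "poly_ring X =
     \<lparr>carrier = {p. \<forall>m \<in> Poly_Mapping.keys p. Poly_Mapping.keys m \<subseteq> X},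
      mult = (*), one = 1, zero = 0, add = (+)\<rparr>"

text \<open>The algebra homomorphism that substitutes \<open>g x\<close> for each variable \<open>x\<close>.\<close>

definition poly_subst ::
    "('x \<Rightarrow> ('y, 'k) mpoly) \<Rightarrow> ('x, 'k::comm_ring_1) mpoly \<Rightarrow> ('y, 'k) mpoly" where
  "poly_subst g p =
     (\<Sum>m \<in> Poly_Mapping.keys p. mconst (Poly_Mapping.lookup p m) *
        (\<Prod>x \<in> Poly_Mapping.keys m. g x ^ Poly_Mapping.lookup m x))"

definition saturation :: "('a, 'b) ring_scheme \<Rightarrow> 'a set \<Rightarrow> 'a \<Rightarrow> 'a set" where
  "saturation R I f = {g \<in> carrier R. \<exists>m::nat. f [^]\<^bsub>R\<^esub> m \<otimes>\<^bsub>R\<^esub> g \<in> I}"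


section \<open>Toric ideals of graphs\<close>

text \<open>
  The variables of the source ring are the edges themselves.  Since an edge is the set of its
  two end points, its image \<open>x\<^sub>u x\<^sub>v\<close> is the product over its elements.
\<close>

definition toric_map :: "('v set, 'k) mpoly \<Rightarrow> ('v, 'k::comm_ring_1) mpoly" where
  "toric_map = poly_subst (\<lambda>e. \<Prod>v \<in> e. mvar v)"

definition toric_ideal :: "'v graph \<Rightarrow> ('v set, 'k::comm_ring_1) mpoly set" where
  "toric_ideal G = a_kernel (poly_ring (edges G)) (poly_ring (verts G)) toric_map"

text \<open>For a subgraph \<open>G'\<close> of \<open>G\<close>, the extension of its toric ideal to the ring of \<open>G\<close>.\<close>

definition toric_ideal_in :: "'v graph \<Rightarrow> 'v graph \<Rightarrow> ('v set, 'k::comm_ring_1) mpoly set" where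
  "toric_ideal_in G G' = Idl\<^bsub>poly_ring (edges G)\<^esub> (toric_ideal G')"

text \<open>
  For an isomorphism \<open>\<phi>\<close> from \<open>path_graph l\<close>, the edges of the path are
  \<open>h\<^sub>k = {\<phi> k, \<phi> (k + 1)}\<close> with \<open>1 \<le> k \<le> l\<close>; the two choices of \<open>\<phi>\<close> are the two
  consecutive labellings.
\<close>

definition even_edge_product :: "nat \<Rightarrow> (nat \<Rightarrow> 'v) \<Rightarrow> ('v set, 'k::comm_ring_1) mpoly" where
  "even_edge_product l \<phi> = (\<Prod>k \<in> {k \<in> {1..l}. 2 dvd k}. mvar {\<phi> k, \<phi> (k + 1)})"


section \<open>Well-definedness\<close>

lemma poly_ring_mult_closed:
  fixes p q :: "('x, 'k::comm_ring_1) mpoly"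
  assumes "p \<in> carrier (poly_ring X)" "q \<in> carrier (poly_ring X)"
  shows "p * q \<in> carrier (poly_ring X)"
proof -
  have "Poly_Mapping.keys m \<subseteq> X" if m: "m \<in> Poly_Mapping.keys (p * q)" for m
  proof -
    obtain a b where "m = a + b" "a \<in> Poly_Mapping.keys p" "b \<in> Poly_Mapping.keys q"
      using m keys_mult[of p q] by blast
    then show ?thesis
      using assms Poly_Mapping.keys_add[of a b] unfolding poly_ring_def by fastforce
  qed
  then show ?thesis by (simp add: poly_ring_def)
qed

lemma poly_ring_cring: "cring (poly_ring X :: ('x, 'k::comm_ring_1) mpoly ring)"
proof (rule cringI)
  let ?R = "poly_ring X :: ('x, 'k) mpoly ring"
  have R_simps: "p \<otimes>\<^bsub>?R\<^esub> q = p * q" "p \<oplus>\<^bsub>?R\<^esub> q = p + q" "\<zero>\<^bsub>?R\<^esub> = 0" "\<one>\<^bsub>?R\<^esub> = 1" for p q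
    by (simp_all add: poly_ring_def)
  have zero_one: "0 \<in> carrier ?R" "1 \<in> carrier ?R"
    by (simp_all add: poly_ring_def)
  have add: "p + q \<in> carrier ?R" if "p \<in> carrier ?R" "q \<in> carrier ?R" for p q
    using that Poly_Mapping.keys_add[of p q] unfolding poly_ring_def by fastforce
  have uminus: "- p \<in> carrier ?R" if "p \<in> carrier ?R" for p
    using that by (auto simp: poly_ring_def in_keys_iff)
  show "abelian_group ?R"
  proof (rule abelian_groupI)
    fix p assume "p \<in> carrier ?R"
    then show "\<exists>q \<in> carrier ?R. q \<oplus>\<^bsub>?R\<^esub> p = \<zero>\<^bsub>?R\<^esub>"
      by (intro bexI[of _ "- p"] uminus) (simp_all add: R_simps)
  qed (simp_all only: R_simps add zero_one add.assoc add.left_neutral, simp_all only: add.commute)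
  show "Group.comm_monoid ?R"
    by (rule comm_monoidI)
      (simp_all only: R_simps poly_ring_mult_closed zero_one mult.assoc mult_1_left,
        simp_all only: mult.commute)
  show "(p \<oplus>\<^bsub>?R\<^esub> q) \<otimes>\<^bsub>?R\<^esub> r = (p \<otimes>\<^bsub>?R\<^esub> r) \<oplus>\<^bsub>?R\<^esub> (q \<otimes>\<^bsub>?R\<^esub> r)" for p q r
    by (simp only: R_simps distrib_right)
qed

lemma mconst_in_poly_ring: "mconst c \<in> carrier (poly_ring X)"
  by (simp add: mconst_def poly_ring_def)

lemma mvar_in_poly_ring: "x \<in> X \<Longrightarrow> mvar x \<in> carrier (poly_ring X)"
  by (simp add: mvar_def poly_ring_def)

lemma poly_subst_single:
  "poly_subst g (Poly_Mapping.single m c) =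
     mconst c * (\<Prod>x \<in> Poly_Mapping.keys m. g x ^ Poly_Mapping.lookup m x)"
  by (simp add: poly_subst_def mconst_def)

lemma poly_subst_mconst: "poly_subst g (mconst c) = mconst c"
  unfolding mconst_def[of c] by (simp add: poly_subst_single mconst_def)

lemma poly_subst_mvar: "poly_subst g (mvar x) = g x"
  by (simp add: mvar_def poly_subst_single mconst_def)

lemma poly_subst_add: "poly_subst g (p + q) = poly_subst g p + poly_subst g q"
  unfolding poly_subst_def
  by (rule setsum_keys_plus_distrib) (simp_all add: mconst_def single_add distrib_right)

lemma monomial_subst_add:
  fixes g :: "'x \<Rightarrow> ('y, 'k::comm_ring_1) mpoly"
  shows "(\<Prod>x \<in> Poly_Mapping.keys (a + b). g x ^ Poly_Mapping.lookup (a + b) x) =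
    (\<Prod>x \<in> Poly_Mapping.keys a. g x ^ Poly_Mapping.lookup a x) *
    (\<Prod>x \<in> Poly_Mapping.keys b. g x ^ Poly_Mapping.lookup b x)"
proof -
  let ?K = "Poly_Mapping.keys a \<union> Poly_Mapping.keys b"
  have *: "(\<Prod>x \<in> Poly_Mapping.keys c. g x ^ Poly_Mapping.lookup c x) =
      (\<Prod>x \<in> ?K. g x ^ Poly_Mapping.lookup c x)" if "Poly_Mapping.keys c \<subseteq> ?K" for c
    by (rule prod.mono_neutral_left) (use that in \<open>auto simp: in_keys_iff\<close>)
  show ?thesis
    using Poly_Mapping.keys_add[of a b]
    by (subst (1 2 3) *) (auto simp: lookup_add power_add prod.distrib)
qed

lemma mpoly_induct [case_names zero single add]:
  fixes p :: "('x, 'k::comm_ring_1) mpoly"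
  assumes "P 0" "\<And>m c. P (Poly_Mapping.single m c)" "\<And>p q. P p \<Longrightarrow> P q \<Longrightarrow> P (p + q)"
  shows "P p"
proof (induction p rule: update_induct)
  case (update p m c)
  then have "Poly_Mapping.update m c p = p + Poly_Mapping.single m c"
    by (intro poly_mapping_eqI) (auto simp: lookup_update lookup_add lookup_single in_keys_iff when_def)
  then show ?case using update assms by simp
qed (use assms in simp)

lemma poly_subst_mult:
  fixes g :: "'a \<Rightarrow> ('b, 'c::comm_ring_1) mpoly"
  shows "poly_subst g (p * q) = poly_subst g p * poly_subst g q"
proof (induction p rule: mpoly_induct)
  case (single m c)
  show ?case
  proof (induction q rule: mpoly_induct)
    case (single n d)
    have "mconst (c * d) = (mconst c * mconst d :: ('b, 'c) mpoly)"
      by (simp add: mconst_def mult_single)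
    then show ?case
      by (simp add: mult_single poly_subst_single monomial_subst_add mult_ac)
  qed (simp_all add: poly_subst_def[of g 0] poly_subst_add distrib_left)
qed (simp_all add: poly_subst_def[of g 0] poly_subst_add distrib_right)

lemma poly_subst_ring_hom:
  fixes g :: "'x \<Rightarrow> ('y, 'k::comm_ring_1) mpoly"
  assumes "\<And>x. x \<in> X \<Longrightarrow> g x \<in> carrier (poly_ring Y)"
  shows "poly_subst g \<in> ring_hom (poly_ring X) (poly_ring Y)"
proof (rule ring_hom_memI)
  let ?S = "poly_ring Y :: ('y, 'k) mpoly ring"
  interpret S: cring ?S by (rule poly_ring_cring)
  have S_simps: "p \<otimes>\<^bsub>?S\<^esub> q = p * q" "p \<oplus>\<^bsub>?S\<^esub> q = p + q" "\<zero>\<^bsub>?S\<^esub> = 0" "\<one>\<^bsub>?S\<^esub> = 1" for p q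
    by (simp_all add: poly_ring_def)
  have power: "p ^ n \<in> carrier ?S" if "p \<in> carrier ?S" for p and n :: nat
    by (induction n) (use that S.one_closed S.m_closed in \<open>simp_all add: S_simps\<close>)
  have prod: "(\<Prod>x \<in> A. f x) \<in> carrier ?S" if "\<And>x. x \<in> A \<Longrightarrow> f x \<in> carrier ?S"
    for A and f :: "'x \<Rightarrow> ('y, 'k) mpoly"
    using that
    by (induction A rule: infinite_finite_induct)
      (use S.one_closed S.m_closed in \<open>simp_all add: S_simps\<close>)
  have sum: "(\<Sum>x \<in> A. f x) \<in> carrier ?S" if "\<And>x. x \<in> A \<Longrightarrow> f x \<in> carrier ?S"
    for A and f :: "('x \<Rightarrow>\<^sub>0 nat) \<Rightarrow> ('y, 'k) mpoly"
    using that
    by (induction A rule: infinite_finite_induct)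
      (use S.zero_closed S.a_closed in \<open>simp_all add: S_simps\<close>)
  fix p assume p: "p \<in> carrier (poly_ring X :: ('x, 'k) mpoly ring)"
  show "poly_subst g p \<in> carrier ?S"
    unfolding poly_subst_def
    by (intro sum poly_ring_mult_closed mconst_in_poly_ring prod power assms)
      (use p in \<open>auto simp: poly_ring_def\<close>)
next
  show "poly_subst g \<one>\<^bsub>poly_ring X\<^esub> = \<one>\<^bsub>poly_ring Y\<^esub>"
    using poly_subst_mconst[of g 1] by (simp add: poly_ring_def mconst_def)
qed (simp_all add: poly_ring_def poly_subst_add poly_subst_mult)

lemma toric_map_edge:
  assumes "u \<noteq> v"
  shows "toric_map (mvar {u, v}) = mvar u * mvar v"
  using assms by (simp add: toric_map_def poly_subst_mvar)

lemma toric_map_ring_hom: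
  assumes "finite_simple_graph G"
  shows "toric_map \<in> ring_hom (poly_ring (edges G))
    (poly_ring (verts G) :: ('v, 'k::comm_ring_1) mpoly ring)"
  unfolding toric_map_def
proof (rule poly_subst_ring_hom)
  fix e assume "e \<in> edges G"
  then obtain u v where "e = {u, v}" "u \<noteq> v" "u \<in> verts G" "v \<in> verts G"
    using assms by (auto simp: finite_simple_graph_def)
  then show "(\<Prod>x \<in> e. mvar x) \<in> carrier (poly_ring (verts G) :: ('v, 'k) mpoly ring)"
    by (simp add: poly_ring_mult_closed mvar_in_poly_ring)
qed

end

(*
  A toric ideal is spanned by differences of monomials x^a - x^b whose exponents a, b have the
  same vertex degrees.  Split such exponents into the part on the edges of G1 and the rest.  The
  vertex degrees of the two G1-parts can only differ at the two ends of the path, because the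
  interior vertices of H meet no edge outside H, and bipartiteness of G1 relates the two
  discrepancies.  The difference (product of odd path edges) - (product of even path edges) has
  degrees of exactly the same shape, so multiplying by a power of f allows one to trade even path
  edges against odd ones and to correct the discrepancy in G1 and in G2 separately.
*)
theory Submission
  imports Defs "HOL-Algebra.RingHom"
begin

section \<open>Monomials and their vertex degrees\<close>

text \<open>For finite edges this is the exponent vector of the image of the monomial
  \<open>m\<close> under the toric map: the vertex degrees of the multigraph with edge
  multiplicities \<open>m\<close>.\<close>

definition edge_degree :: "('v set \<Rightarrow>\<^sub>0 nat) \<Rightarrow> ('v \<Rightarrow>\<^sub>0 nat)" where
  "edge_degree m = (\<Sum>e \<in> Poly_Mapping.keys m. \<Sum>v \<in> e. Poly_Mapping.single v (Poly_Mapping.lookup m e))"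

lemma prod_single_one:
  "(\<Prod>i \<in> A. Poly_Mapping.single (g i) (1::'k::comm_ring_1)) =
    Poly_Mapping.single (\<Sum>i \<in> A. g i :: 'x \<Rightarrow>\<^sub>0 nat) 1"
  by (induction A rule: infinite_finite_induct) (simp_all add: mult_single)

text \<open>The \<open>n\<close>-fold multiple of an exponent vector is written as a constant sum,
  over which \<open>edge_degree\<close> and \<open>lookup\<close> distribute.\<close>

lemma single_one_power:
  "Poly_Mapping.single (m :: 'x \<Rightarrow>\<^sub>0 nat) (1::'k::comm_ring_1) ^ n =
    Poly_Mapping.single (\<Sum>i<n. m) 1"
  using prod_single_one[of "\<lambda>_. m" "{..<n}"] by simp

lemma sum_const_single: "(\<Sum>i<n. Poly_Mapping.single v (1::nat)) = Poly_Mapping.single v n"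
  by (rule poly_mapping_eqI) (auto simp: lookup_sum lookup_single when_def)

lemma toric_map_single:
  fixes m :: "'v set \<Rightarrow>\<^sub>0 nat"
  shows
  "toric_map (Poly_Mapping.single m c) = Poly_Mapping.single (edge_degree m) (c::'k::comm_ring_1)"
proof -
  \<comment> \<open>This covers infinite \<open>e\<close> as well: there the product defaults to 1
    and the sum to 0.\<close>
  have "(\<Prod>v \<in> e. mvar v) ^ n = (Poly_Mapping.single (\<Sum>v \<in> e. Poly_Mapping.single v n) 1
      :: ('v, 'k) mpoly)" for e :: "'v set" and n
  proof -
    have "(\<Prod>v \<in> e. mvar v) ^ n = (\<Prod>v \<in> e. mvar v ^ n :: ('v, 'k) mpoly)"
      by (simp add: prod_power_distrib)
    also have "\<dots> = Poly_Mapping.single (\<Sum>v \<in> e. Poly_Mapping.single v n) 1"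
      unfolding mvar_def single_one_power sum_const_single prod_single_one ..
    finally show ?thesis .
  qed
  then have "(\<Prod>e \<in> Poly_Mapping.keys m. (\<Prod>v \<in> e. mvar v) ^ Poly_Mapping.lookup m e) =
      (Poly_Mapping.single (edge_degree m) 1 :: ('v, 'k) mpoly)"
    by (simp only: edge_degree_def prod_single_one)
  then show ?thesis
    by (simp add: toric_map_def poly_subst_single mconst_def mult_single)
qed

lemma toric_map_add: "toric_map (p + q) = toric_map p + toric_map q"
  by (simp add: toric_map_def poly_subst_add)

lemma toric_map_mult: "toric_map (p * q) = toric_map p * toric_map q"
  by (simp add: toric_map_def poly_subst_mult)

lemma toric_map_minus:
  "toric_map (p - q) = toric_map p - (toric_map q :: ('v, 'k::comm_ring_1) mpoly)"
  using toric_map_add[of "p - q" q] by (simp add: algebra_simps)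

text \<open>In this form single coefficients of the image can be read off.\<close>

lemma toric_map_eq_sum:
  "toric_map p = (\<Sum>m \<in> Poly_Mapping.keys p. Poly_Mapping.single (edge_degree m)
     (Poly_Mapping.lookup p m :: 'k::comm_ring_1))"
  unfolding toric_map_single[symmetric] by (simp add: toric_map_def poly_subst_single)
     (simp add: poly_subst_def)

lemma edge_degree_add: "edge_degree (a + b) = edge_degree a + edge_degree b"
  unfolding edge_degree_def
  by (rule setsum_keys_plus_distrib) (simp_all add: single_add sum.distrib)

lemma edge_degree_sum: "edge_degree (\<Sum>i \<in> A. g i) = (\<Sum>i \<in> A. edge_degree (g i))"
  by (induction A rule: infinite_finite_induct)
    (simp_all add: edge_degree_add, simp_all add: edge_degree_def)

lemma lookup_edge_degree:
  assumes "\<And>e. e \<in> Poly_Mapping.keys m \<Longrightarrow> finite e"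
  shows "Poly_Mapping.lookup (edge_degree m) v =
    (\<Sum>e \<in> Poly_Mapping.keys m. if v \<in> e then Poly_Mapping.lookup m e else 0)"
  unfolding edge_degree_def lookup_sum
  by (rule sum.cong) (use assms in \<open>auto simp: lookup_single when_def\<close>)

lemma lookup_edge_degree_eq_0:
  assumes "\<And>e. e \<in> Poly_Mapping.keys m \<Longrightarrow> finite e \<and> v \<notin> e"
  shows "Poly_Mapping.lookup (edge_degree m) v = 0"
  using assms by (simp add: lookup_edge_degree)

text \<open>Double counting: every edge of \<open>m\<close> has exactly one end in
  \<open>A\<close>.\<close>

lemma edge_degree_bipartite:
  assumes "finite A" "A \<inter> B = {}"
    and "\<And>e. e \<in> Poly_Mapping.keys m \<Longrightarrow> \<exists>a \<in> A. \<exists>b \<in> B. e = {a, b}"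
  shows "(\<Sum>v \<in> A. Poly_Mapping.lookup (edge_degree m) v) =
    (\<Sum>e \<in> Poly_Mapping.keys m. Poly_Mapping.lookup m e)"
proof -
  have fin: "finite e" if "e \<in> Poly_Mapping.keys m" for e
    using assms(3)[OF that] by auto
  have "(\<Sum>v \<in> A. Poly_Mapping.lookup (edge_degree m) v) =
      (\<Sum>e \<in> Poly_Mapping.keys m. \<Sum>v \<in> A. if v \<in> e then Poly_Mapping.lookup m e else 0)"
    by (simp only: lookup_edge_degree[OF fin]) (rule sum.swap)
  also have "\<dots> = (\<Sum>e \<in> Poly_Mapping.keys m. Poly_Mapping.lookup m e)"
  proof (rule sum.cong)
    fix e assume "e \<in> Poly_Mapping.keys m"
    then obtain a b where ab: "a \<in> A" "b \<in> B" "e = {a, b}" using assms(3) by blast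
    then have "v \<in> A \<Longrightarrow> v \<in> e \<longleftrightarrow> v = a" for v using assms(2) by auto
    then have "(\<Sum>v \<in> A. if v \<in> e then Poly_Mapping.lookup m e else 0) =
        (\<Sum>v \<in> A. if v = a then Poly_Mapping.lookup m e else 0)"
      by (intro sum.cong) auto
    then show "(\<Sum>v \<in> A. if v \<in> e then Poly_Mapping.lookup m e else 0) = Poly_Mapping.lookup m e"
      using ab assms(1) by simp
  qed simp
  finally show ?thesis .
qed

text \<open>Serves to separate an exponent vector into its part on the edges of G1 and the
  rest.\<close>

lemma poly_mapping_split_keys:
  fixes a :: "'x \<Rightarrow>\<^sub>0 nat"
  obtains a1 a2 where "a = a1 + a2" "Poly_Mapping.keys a1 = Poly_Mapping.keys a \<inter> X"
    "Poly_Mapping.keys a2 = Poly_Mapping.keys a - X"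
proof -
  define r where "r S = (\<Sum>x \<in> Poly_Mapping.keys a \<inter> S.
    Poly_Mapping.single x (Poly_Mapping.lookup a x))" for S
  have lookup_r: "Poly_Mapping.lookup (r S) x = (if x \<in> S then Poly_Mapping.lookup a x else 0)"
    for S x
    by (auto simp: r_def lookup_sum lookup_single when_def in_keys_iff)
  show thesis
  proof
    show "a = r X + r (- X)"
      by (rule poly_mapping_eqI) (simp add: lookup_add lookup_r)
    show "Poly_Mapping.keys (r X) = Poly_Mapping.keys a \<inter> X"
      and "Poly_Mapping.keys (r (- X)) = Poly_Mapping.keys a - X"
      by (auto simp: in_keys_iff lookup_r split: if_splits)
  qed
qed

text \<open>Multiplication by a monomial only shifts exponents by \<open>m\<close>, so every
  coefficient of \<open>p\<close> reappears in the product. This works over any commutative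
  ring.\<close>

lemma single_one_mult_eq_0:
  fixes p :: "('x, 'k::comm_ring_1) mpoly"
  assumes "Poly_Mapping.single m 1 * p = 0"
  shows "p = 0"
proof (rule ccontr)
  assume "p \<noteq> 0"
  have "Poly_Mapping.lookup (Poly_Mapping.single m 1 * p) (m + n) = Poly_Mapping.lookup p n" for n
  proof (induction p rule: mpoly_induct)
    case (single k c)
    then show ?case by (simp add: mult_single lookup_single when_def)
  qed (simp_all add: distrib_left lookup_add)
  then have "p = 0" using assms by (intro poly_mapping_eqI) simp
  then show False using \<open>p \<noteq> 0\<close> by simp
qed

section \<open>Toric ideals\<close>

lemma poly_ring_simps:
  "p \<otimes>\<^bsub>poly_ring X\<^esub> q = p * q" "p \<oplus>\<^bsub>poly_ring X\<^esub> q = p + q"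
  "\<zero>\<^bsub>poly_ring X\<^esub> = 0" "\<one>\<^bsub>poly_ring X\<^esub> = 1"
  by (simp_all add: poly_ring_def)

lemma poly_ring_nat_pow: "p [^]\<^bsub>poly_ring X\<^esub> (n::nat) = p ^ n"
proof -
  interpret cring "poly_ring X :: ('a, 'b) mpoly ring" by (rule poly_ring_cring)
  show ?thesis by (induction n) (simp_all add: poly_ring_simps mult.commute)
qed

lemma poly_ring_power_closed:
  assumes "p \<in> carrier (poly_ring X)"
  shows "p ^ n \<in> carrier (poly_ring X)"
proof -
  interpret cring "poly_ring X :: ('a, 'b) mpoly ring" by (rule poly_ring_cring)
  show ?thesis using nat_pow_closed[OF assms] by (simp add: poly_ring_nat_pow)
qed

lemma single_in_poly_ring:
  "Poly_Mapping.keys m \<subseteq> X \<Longrightarrow> Poly_Mapping.single m c \<in> carrier (poly_ring X)"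
  by (simp add: poly_ring_def)

lemma poly_ring_diff_closed:
  assumes "p \<in> carrier (poly_ring X)" "q \<in> carrier (poly_ring X)"
  shows "p - q \<in> carrier (poly_ring X)"
  using assms keys_diff[of p q] by (fastforce simp: poly_ring_def)

lemma poly_ring_ideal_zero: "ideal I (poly_ring X) \<Longrightarrow> 0 \<in> I"
  using additive_subgroup.zero_closed[OF ideal.axioms(1), of I "poly_ring X"]
  by (simp add: poly_ring_simps)

lemma poly_ring_ideal_add: "ideal I (poly_ring X) \<Longrightarrow> p \<in> I \<Longrightarrow> q \<in> I \<Longrightarrow> p + q \<in> I"
  using additive_subgroup.a_closed[OF ideal.axioms(1), of I "poly_ring X" p q]
  by (simp add: poly_ring_simps)

lemma poly_ring_ideal_mult:
  "ideal I (poly_ring X) \<Longrightarrow> p \<in> I \<Longrightarrow> q \<in> carrier (poly_ring X) \<Longrightarrow> q * p \<in> I"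
  using ideal.I_l_closed[of I "poly_ring X" p q] by (simp add: poly_ring_simps)

section \<open>Toric ideals as kernels spanned by binomials\<close>

lemma toric_ideal_iff:
  "p \<in> toric_ideal G \<longleftrightarrow> p \<in> carrier (poly_ring (edges G)) \<and> toric_map p = 0"
  by (simp add: toric_ideal_def a_kernel_def' poly_ring_simps)

lemma toric_ideal_ideal:
  assumes "finite_simple_graph G"
  shows "ideal (toric_ideal G :: ('v set, 'k::comm_ring_1) mpoly set) (poly_ring (edges G))"
proof -
  interpret ring_hom_ring "poly_ring (edges G)" "poly_ring (verts G) :: ('v, 'k) mpoly ring" toric_map
    by (intro ring_hom_ringI2 cring.axioms(1) poly_ring_cring toric_map_ring_hom assms)
  show ?thesis unfolding toric_ideal_def by (rule kernel_is_ideal)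
qed

lemma binomial_in_toric_ideal:
  assumes "Poly_Mapping.keys a \<subseteq> edges G" "Poly_Mapping.keys b \<subseteq> edges G"
    and "edge_degree a = edge_degree b"
  shows "Poly_Mapping.single a c - Poly_Mapping.single b (c::'k::comm_ring_1) \<in> toric_ideal G"
  using assms
  by (simp add: toric_ideal_iff toric_map_minus toric_map_single poly_ring_diff_closed
      single_in_poly_ring)

text \<open>Monomials of equal degree vector must cancel in the image, so each monomial of
  \<open>p\<close> has a partner in \<open>p\<close>. Subtracting a multiple of their difference
  shortens \<open>p\<close>.\<close>

lemma toric_ideal_induct [consumes 1, case_names zero add binomial]:
  fixes p :: "('v set, 'k::comm_ring_1) mpoly"
  assumes "p \<in> toric_ideal G"
    and zero: "P 0"
    and add: "\<And>p q. P p \<Longrightarrow> P q \<Longrightarrow> P (p + q)"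
    and binomial: "\<And>a b c. Poly_Mapping.keys a \<subseteq> edges G \<Longrightarrow> Poly_Mapping.keys b \<subseteq> edges G \<Longrightarrow>
      edge_degree a = edge_degree b \<Longrightarrow> P (Poly_Mapping.single a c - Poly_Mapping.single b c)"
  shows "P p"
  using assms(1)
proof (induction "card (Poly_Mapping.keys p)" arbitrary: p rule: less_induct)
  case less
  have keys: "m \<in> Poly_Mapping.keys p \<Longrightarrow> Poly_Mapping.keys m \<subseteq> edges G" for m
    using less.prems by (auto simp: toric_ideal_iff poly_ring_def)
  show ?case
  proof (cases "p = 0")
    case True
    then show ?thesis using zero by simp
  next
    case False
    then obtain a where a: "a \<in> Poly_Mapping.keys p"
      by (metis all_not_in_conv keys_eq_empty)
    \<comment> \<open>Without a partner, the coefficient of the image at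
      \<open>edge_degree a\<close> would be the nonzero coefficient of \<open>p\<close> at
      \<open>a\<close>.\<close>
    have "\<exists>b \<in> Poly_Mapping.keys p. b \<noteq> a \<and> edge_degree a = edge_degree b"
    proof (rule ccontr)
      assume "\<not> ?thesis"
      then have "Poly_Mapping.lookup (toric_map p) (edge_degree a) =
          (\<Sum>m \<in> Poly_Mapping.keys p. if m = a then Poly_Mapping.lookup p m else 0)"
        unfolding toric_map_eq_sum lookup_sum
        by (intro sum.cong) (auto simp: lookup_single when_def)
      also have "\<dots> = Poly_Mapping.lookup p a" using a by simp
      finally show False using less.prems a by (simp add: toric_ideal_iff in_keys_iff)
    qed
    then obtain b where b: "b \<in> Poly_Mapping.keys p" "b \<noteq> a" "edge_degree a = edge_degree b"
      by blast
    define q where "q = Poly_Mapping.single a (Poly_Mapping.lookup p a) -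
      Poly_Mapping.single b (Poly_Mapping.lookup p a)"
    have q: "q \<in> toric_ideal G"
      unfolding q_def using a b keys by (intro binomial_in_toric_ideal) auto
    \<comment> \<open>The monomial \<open>a\<close> disappears, and \<open>b\<close> was already
      present, so nothing new enters.\<close>
    have "Poly_Mapping.keys (p - q) \<subseteq> Poly_Mapping.keys p - {a}"
      using a b by (auto simp: q_def in_keys_iff lookup_minus lookup_single when_def split: if_splits)
    then have "card (Poly_Mapping.keys (p - q)) < card (Poly_Mapping.keys p)"
      using a by (intro psubset_card_mono) auto
    moreover have "p - q \<in> toric_ideal G"
      using less.prems q by (simp add: toric_ideal_iff toric_map_minus poly_ring_diff_closed)
    ultimately have "P (p - q)" by (rule less.hyps)
    moreover have "P q" unfolding q_def using a b keys by (intro binomial) auto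
    ultimately show ?thesis using add[of "p - q" q] by simp
  qed
qed

text \<open>The image of a monomial is a monomial, which can be cancelled in the vertex
  ring.\<close>

lemma toric_ideal_saturated:
  assumes "Poly_Mapping.single m (1::'k::comm_ring_1) ^ n * p \<in> toric_ideal G"
    and "p \<in> carrier (poly_ring (edges G))"
  shows "p \<in> toric_ideal G"
proof -
  have "Poly_Mapping.single (edge_degree (\<Sum>i<n. m)) 1 * toric_map p = 0"
    using assms(1) by (simp add: toric_ideal_iff toric_map_mult single_one_power toric_map_single)
  then show ?thesis using assms(2) single_one_mult_eq_0 toric_ideal_iff by blast
qed

lemma toric_ideal_mono:
  "edges G' \<subseteq> edges G \<Longrightarrow> toric_ideal G' \<subseteq> toric_ideal G"
  by (fastforce simp: toric_ideal_iff poly_ring_def)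

section \<open>Splittings along a path\<close>

text \<open>The hypotheses in terms of vertex sets. \<open>interior\<close> is the form in which the
  degree condition enters; \<open>A\<close> and \<open>B\<close> are a fixed bipartition of
  G1.\<close>

locale path_splitting =
  fixes G :: "'v graph" and W1 W2 A B :: "'v set" and l :: nat and \<phi> :: "nat \<Rightarrow> 'v"
  assumes simple: "finite_simple_graph G"
    and cover: "W1 \<union> W2 = verts G"
    and no_cross: "\<And>u v. u \<in> W1 - W2 \<Longrightarrow> v \<in> W2 - W1 \<Longrightarrow> {u, v} \<notin> edges G"
    and l_pos: "l \<ge> 1"
    and \<phi>: "bij_betw \<phi> {1..l + 1} (W1 \<inter> W2)"
    and path_edge: "\<And>k. k \<in> {1..l} \<Longrightarrow> {\<phi> k, \<phi> (k + 1)} \<in> edges G"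
    and interior: "\<And>k e. k \<in> {2..l} \<Longrightarrow> e \<in> edges G \<Longrightarrow> \<phi> k \<in> e \<Longrightarrow> e \<subseteq> W1 \<inter> W2"
    and parts: "A \<union> B = W1" "A \<inter> B = {}"
    and bip: "\<And>e. e \<in> edges G \<Longrightarrow> e \<subseteq> W1 \<Longrightarrow> \<exists>a \<in> A. \<exists>b \<in> B. e = {a, b}"
begin

text \<open>Integer values allow discrepancies of either sign.\<close>

abbreviation deg :: "('v set \<Rightarrow>\<^sub>0 nat) \<Rightarrow> 'v \<Rightarrow> int" where
  "deg m v \<equiv> int (Poly_Mapping.lookup (edge_degree m) v)"

abbreviation "E1 \<equiv> {e \<in> edges G. e \<subseteq> W1}"
abbreviation "E2 \<equiv> {e \<in> edges G. e \<subseteq> W2}"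

text \<open>\<open>path_part even\<close> is the exponent vector of f, and
  \<open>path_part odd\<close> that of the complementary product it is traded against.\<close>

definition path_part :: "(nat \<Rightarrow> bool) \<Rightarrow> 'v set \<Rightarrow>\<^sub>0 nat" where
  "path_part P = (\<Sum>k \<in> {k \<in> {1..l}. P k}. Poly_Mapping.single {\<phi> k, \<phi> (k + 1)} 1)"

section \<open>Edges of the splitting and of the path\<close>

lemma edge_cases:
  assumes "e \<in> edges G"
  obtains u v where "e = {u, v}" "u \<noteq> v" "e \<subseteq> W1 \<or> e \<subseteq> W2"
proof -
  obtain u v where uv: "e = {u, v}" "u \<noteq> v" "u \<in> W1 \<union> W2" "v \<in> W1 \<union> W2"
    using assms simple cover by (auto simp: finite_simple_graph_def)
  \<comment> \<open>Otherwise \<open>e\<close> would join \<open>W1 - W2\<close> to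
    \<open>W2 - W1\<close>; either end may lie on either side, hence the two instances.\<close>
  then have "e \<subseteq> W1 \<or> e \<subseteq> W2"
    using no_cross[of u v] no_cross[of v u] assms by (auto simp: insert_commute)
  then show thesis using uv that by blast
qed

lemma finite_edge: "e \<in> edges G \<Longrightarrow> finite e"
  by (erule edge_cases) simp

lemma finite_W1: "finite W1"
  using simple cover by (metis finite_Un finite_simple_graph_def)

lemma \<phi>_inj: "i \<in> {1..l + 1} \<Longrightarrow> j \<in> {1..l + 1} \<Longrightarrow> \<phi> i = \<phi> j \<longleftrightarrow> i = j"
  using \<phi> by (auto simp: bij_betw_def inj_on_def)

lemma \<phi>_mem: "k \<in> {1..l + 1} \<Longrightarrow> \<phi> k \<in> W1 \<inter> W2"
  using \<phi> by (auto simp: bij_betw_def)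

lemma path_vertex_cases:
  assumes "v \<in> W1 \<inter> W2"
  obtains k where "k \<in> {1..l + 1}" "v = \<phi> k"
proof -
  have "v \<in> \<phi> ` {1..l + 1}" using assms \<phi> unfolding bij_betw_def by simp
  then show thesis using that by (elim imageE)
qed

text \<open>Path edges belong to both halves, so they may be used in a binomial of G1 as well as in
  one of G2.\<close>

lemma keys_path_part: "Poly_Mapping.keys (path_part P) \<subseteq> E1 \<inter> E2"
proof
  fix e assume "e \<in> Poly_Mapping.keys (path_part P)"
  then have "e \<in> (\<Union>k \<in> {k \<in> {1..l}. P k}.
      Poly_Mapping.keys (Poly_Mapping.single {\<phi> k, \<phi> (k + 1)} (1::nat)))"
    unfolding path_part_def by (rule subsetD[OF keys_sum])
  then obtain k where k: "k \<in> {1..l}" and e: "e = {\<phi> k, \<phi> (k + 1)}" by auto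
  show "e \<in> E1 \<inter> E2"
    using k path_edge[OF k] \<phi>_mem[of k] \<phi>_mem[of "k + 1"] unfolding e by auto
qed

text \<open>Among the path edges only those with indices \<open>j - 1\<close> and \<open>j\<close>
  meet \<open>\<phi> j\<close>; the guards remove the missing one at each end of the path.\<close>

lemma deg_path_part:
  assumes "j \<in> {1..l + 1}"
  shows "deg (path_part P) (\<phi> j) =
    of_bool (j \<le> l \<and> P j) + of_bool (2 \<le> j \<and> P (j - 1))"
proof -
  let ?S = "{k \<in> {1..l}. P k}"
  have "Poly_Mapping.lookup (edge_degree (Poly_Mapping.single {\<phi> k, \<phi> (k + 1)} (1::nat))) (\<phi> j) =
      (if k = j then 1 else 0) + (if k = j - 1 \<and> 2 \<le> j then 1 else 0)" if "k \<in> ?S" for k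
  proof -
    have "\<phi> j = \<phi> k \<longleftrightarrow> k = j" "\<phi> j = \<phi> (k + 1) \<longleftrightarrow> k = j - 1 \<and> 2 \<le> j"
      using that assms \<phi>_inj[of j k] \<phi>_inj[of j "k + 1"] by auto
    then show ?thesis by (subst lookup_edge_degree) auto
  qed
  then have "Poly_Mapping.lookup (edge_degree (path_part P)) (\<phi> j) =
      (\<Sum>k \<in> ?S. (if k = j then 1 else 0) + (if k = j - 1 \<and> 2 \<le> j then 1 else 0))"
    unfolding path_part_def edge_degree_sum lookup_sum by (intro sum.cong) auto
  also have "\<dots> = (\<Sum>k \<in> ?S. if k = j then 1 else 0) +
      (\<Sum>k \<in> ?S. if k = j - 1 then of_bool (2 \<le> j) else 0)"
    unfolding sum.distrib by (intro arg_cong2[where f = "(+)"] sum.cong) auto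
  also have "\<dots> = of_bool (j \<le> l \<and> P j) + of_bool (2 \<le> j \<and> P (j - 1))"
    using assms by auto
  finally show ?thesis by simp
qed

section \<open>Degree discrepancies at the path ends and their correction\<close>

lemma deg_outside:
  assumes "Poly_Mapping.keys m \<subseteq> edges G" "\<And>e. e \<in> Poly_Mapping.keys m \<Longrightarrow> v \<notin> e"
  shows "deg m v = 0"
  using assms lookup_edge_degree_eq_0[of m v] finite_edge by auto

text \<open>Both sides count the edges of \<open>m\<close> with multiplicity, once by their ends in
  \<open>A\<close> and once by their ends in \<open>B\<close>.\<close>

lemma deg_balanced:
  assumes "Poly_Mapping.keys m \<subseteq> E1"
  shows "(\<Sum>v \<in> A. deg m v) = (\<Sum>v \<in> B. deg m v)"
proof -
  have fin: "finite A" "finite B" using parts finite_W1 by auto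
  have *: "\<exists>a \<in> A. \<exists>b \<in> B. e = {a, b}" if "e \<in> Poly_Mapping.keys m" for e
    using that assms bip by blast
  have "\<exists>a \<in> B. \<exists>b \<in> A. e = {a, b}" if "e \<in> Poly_Mapping.keys m" for e
    using *[OF that] by (metis insert_commute)
  then show ?thesis
    using edge_degree_bipartite[of A B m] edge_degree_bipartite[of B A m] * fin parts(2)
    by (simp add: Int_commute flip: of_nat_sum)
qed

text \<open>
  The two end discrepancies determine each other through the bipartition, with the same relation
  for \<open>d\<close> and for \<open>d'\<close>; hence they are proportional without regard to the parity of \<open>l\<close>.
\<close>

lemma balanced_ends_proportional:
  fixes d d' :: "'v \<Rightarrow> int"
  assumes "sum d A = sum d B" "sum d' A = sum d' B"
    and supp: "\<And>v. v \<in> W1 \<Longrightarrow> v \<noteq> \<phi> 1 \<Longrightarrow> v \<noteq> \<phi> (l + 1) \<Longrightarrow> d v = 0 \<and> d' v = 0"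
    and "d' (\<phi> 1) = 1" and "v \<in> W1"
  shows "d v = d (\<phi> 1) * d' v"
proof -
  define p q where "p = \<phi> 1" and "q = \<phi> (l + 1)"
  have pq: "p \<noteq> q" "p \<in> A \<union> B" "q \<in> A \<union> B"
    using \<phi>_inj[of 1 "l + 1"] \<phi>_mem[of 1] \<phi>_mem[of "l + 1"] l_pos parts by (auto simp: p_def q_def)
  have fin: "finite A" "finite B" using parts finite_W1 by auto
  \<comment> \<open>By \<open>supp\<close>, only the two path ends can contribute to a sum over one
    part.\<close>
  have ends: "sum g C = (if p \<in> C then g p else 0) + (if q \<in> C then g q else 0)"
    if "C \<in> {A, B}" "g \<in> {d, d'}" for g C
  proof -
    have C: "finite C" "C \<subseteq> W1" using that fin parts by auto
    have "sum g C = sum g (C \<inter> {p, q})"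
      by (rule sum.mono_neutral_right) (use C supp that in \<open>auto simp: p_def q_def\<close>)
    also have "\<dots> = (if p \<in> C then g p else 0) + (if q \<in> C then g q else 0)"
      using pq(1) by (auto simp: Int_insert_right)
    finally show ?thesis .
  qed
  have "d' p = 1" using assms(4) by (simp add: p_def)
  \<comment> \<open>Balance forces equal values at the ends if they lie in different parts, and
    opposite values if they lie in the same part.\<close>
  then have "d q = d p \<and> d' q = 1 \<or> d q = - d p \<and> d' q = - 1"
    using assms(1,2) ends[of A d] ends[of B d] ends[of A d'] ends[of B d'] pq parts(2)
    by (auto simp: disjoint_iff split: if_splits)
  then have "d q = d p * d' q" by auto
  then show ?thesis
    using supp[of v] assms(4,5) by (cases "v = p \<or> v = q") (auto simp: p_def q_def)
qed

text \<open>On \<open>W1\<close> both the discrepancy and the difference of odd and even path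
  degrees are balanced over the bipartition and vanish off the path ends, hence are proportional.
  Off \<open>W1\<close> all of these degrees are 0.\<close>

lemma degree_discrepancy:
  assumes a: "Poly_Mapping.keys a1 \<subseteq> E1" "Poly_Mapping.keys a2 \<subseteq> edges G - E1"
    and b: "Poly_Mapping.keys b1 \<subseteq> E1" "Poly_Mapping.keys b2 \<subseteq> edges G - E1"
    and eq: "edge_degree (a1 + a2) = edge_degree (b1 + b2)"
  shows "deg a1 v - deg b1 v =
    (deg a1 (\<phi> 1) - deg b1 (\<phi> 1)) * (deg (path_part odd) v - deg (path_part even) v)"
proof (cases "v \<in> W1")
  case False
  then have "deg m v = 0" if "Poly_Mapping.keys m \<subseteq> E1" for m
    by (intro deg_outside) (use that in auto)
  then show ?thesis using a b keys_path_part by simp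
next
  case True
  have sub: "Poly_Mapping.keys a1 \<subseteq> edges G" "Poly_Mapping.keys b1 \<subseteq> edges G"
    "Poly_Mapping.keys a2 \<subseteq> edges G" "Poly_Mapping.keys b2 \<subseteq> edges G"
    "Poly_Mapping.keys (path_part P) \<subseteq> edges G" for P
    using a b keys_path_part[of P] by blast+
  have supp: "deg a1 u - deg b1 u = 0 \<and> deg (path_part odd) u - deg (path_part even) u = 0"
    if u: "u \<in> W1" "u \<noteq> \<phi> 1" "u \<noteq> \<phi> (l + 1)" for u
  proof
    \<comment> \<open>Such an edge lies in \<open>W2\<close>, so it could meet \<open>u\<close> only
      at a path vertex. As \<open>u\<close> is not an end, \<open>interior\<close> would put the
      edge inside \<open>W1\<close>.\<close>
    have "u \<notin> e" if e: "e \<in> edges G - E1" for e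
    proof
      assume "u \<in> e"
      have "e \<subseteq> W2" using e by (auto elim: edge_cases)
      then have "u \<in> W1 \<inter> W2" using \<open>u \<in> e\<close> u by auto
      then obtain k where k: "k \<in> {1..l + 1}" "u = \<phi> k" by (rule path_vertex_cases)
      then have "k \<noteq> 1" "k \<noteq> l + 1" using u by auto
      then have "e \<subseteq> W1 \<inter> W2" using k e \<open>u \<in> e\<close> by (intro interior[of k]) auto
      then show False using e by auto
    qed
    then have "u \<notin> e" if "e \<in> Poly_Mapping.keys a2 \<union> Poly_Mapping.keys b2" for e
      using that a(2) b(2) by blast
    then have "deg a2 u = 0" "deg b2 u = 0"
      using deg_outside[OF sub(3), of u] deg_outside[OF sub(4), of u] by simp_all
    then show "deg a1 u - deg b1 u = 0"
      using arg_cong[OF eq, of "\<lambda>m. Poly_Mapping.lookup m u"]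
      by (simp add: edge_degree_add lookup_add)
    show "deg (path_part odd) u - deg (path_part even) u = 0"
    proof (cases "u \<in> W2")
      case True
      then obtain k where k: "k \<in> {1..l + 1}" "u = \<phi> k" using path_vertex_cases u by blast
      then have "k \<noteq> 1" "k \<noteq> l + 1" using u by auto
      \<comment> \<open>Exactly one of the two path edges at an inner vertex has odd index, so both
        degrees are 1.\<close>
      then show ?thesis using k(1) unfolding k(2) deg_path_part[OF k(1)] by auto
    next
      case False
      then have "deg (path_part P) u = 0" for P
        using keys_path_part[of P] sub by (intro deg_outside) auto
      then show ?thesis by simp
    qed
  qed
  show ?thesis
  proof (rule balanced_ends_proportional[where d = "\<lambda>v. deg a1 v - deg b1 v"
        and d' = "\<lambda>v. deg (path_part odd) v - deg (path_part even) v"])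
    show "(\<Sum>v \<in> A. deg a1 v - deg b1 v) = (\<Sum>v \<in> B. deg a1 v - deg b1 v)"
      using a(1) b(1) deg_balanced by (simp add: sum_subtractf)
    show "(\<Sum>v \<in> A. deg (path_part odd) v - deg (path_part even) v) =
        (\<Sum>v \<in> B. deg (path_part odd) v - deg (path_part even) v)"
      using keys_path_part deg_balanced by (simp add: sum_subtractf)
    \<comment> \<open>The only path edge at \<open>\<phi> 1\<close> has the odd index 1.\<close>
    show "deg (path_part odd) (\<phi> 1) - deg (path_part even) (\<phi> 1) = 1"
      using l_pos deg_path_part[of 1] by simp
  qed (use supp True in simp_all)
qed

text \<open>With \<open>n\<close> the discrepancy at \<open>\<phi> 1\<close>, attach
  \<open>n\<close> copies of the even or of the odd path edges to each part. This gives a binomial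
  \<open>s\<close> of G1 and a binomial \<open>t\<close> of G2, which combine to the
  \<open>n\<close>-th power of f times the given binomial.\<close>

lemma binomial_saturated_aux:
  fixes I :: "('v set, 'k::comm_ring_1) mpoly set"
  assumes I: "ideal I (poly_ring (edges G))"
    and I1: "toric_ideal (induced_subgraph G W1) \<subseteq> I"
    and I2: "toric_ideal (induced_subgraph G W2) \<subseteq> I"
    and a: "Poly_Mapping.keys a1 \<subseteq> E1" "Poly_Mapping.keys a2 \<subseteq> edges G - E1"
    and b: "Poly_Mapping.keys b1 \<subseteq> E1" "Poly_Mapping.keys b2 \<subseteq> edges G - E1"
    and eq: "edge_degree (a1 + a2) = edge_degree (b1 + b2)"
    and le: "deg b1 (\<phi> 1) \<le> deg a1 (\<phi> 1)"
  shows "\<exists>n. Poly_Mapping.single (path_part even) 1 ^ n *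
    (Poly_Mapping.single (a1 + a2) c - Poly_Mapping.single (b1 + b2) c) \<in> I"
proof -
  \<comment> \<open>By \<open>le\<close> the difference is nonnegative, so \<open>nat\<close> loses
    nothing.\<close>
  define n where "n = nat (deg a1 (\<phi> 1) - deg b1 (\<phi> 1))"
  define F O' where "F = (\<Sum>i<n. path_part even)" and "O' = (\<Sum>i<n. path_part odd)"
  have keys_sum: "Poly_Mapping.keys (\<Sum>i<n. path_part P) \<subseteq> E1 \<inter> E2" for P
    using keys_sum[of "\<lambda>_. path_part P" "{..<n}"] keys_path_part[of P] by blast
  have keys_FO: "Poly_Mapping.keys F \<subseteq> E1 \<inter> E2" "Poly_Mapping.keys O' \<subseteq> E1 \<inter> E2"
    unfolding F_def O'_def by (rule keys_sum)+
  have "edges G - E1 \<subseteq> E2" by (auto elim: edge_cases)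
  then have keys2: "Poly_Mapping.keys a2 \<subseteq> E2" "Poly_Mapping.keys b2 \<subseteq> E2" using a b by auto
  have keys_add': "Poly_Mapping.keys (x + y) \<subseteq> E"
    if "Poly_Mapping.keys x \<subseteq> E" "Poly_Mapping.keys y \<subseteq> E"
    for x y :: "'v set \<Rightarrow>\<^sub>0 nat" and E
    using that keys_add[of x y] by blast
  have deg_FO: "Poly_Mapping.lookup (edge_degree F) v = n * Poly_Mapping.lookup (edge_degree (path_part even)) v"
    "Poly_Mapping.lookup (edge_degree O') v = n * Poly_Mapping.lookup (edge_degree (path_part odd)) v" for v
    by (simp_all add: F_def O'_def edge_degree_sum lookup_sum)
  have "int n = deg a1 (\<phi> 1) - deg b1 (\<phi> 1)" using le by (simp add: n_def)
  \<comment> \<open>The discrepancy is \<open>n\<close> times that of odd against even path edges,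
    so adding \<open>F\<close> to \<open>a1\<close> and \<open>O'\<close> to \<open>b1\<close>
    removes it.\<close>
  then have "deg a1 v - deg b1 v = deg O' v - deg F v" for v
    using degree_discrepancy[OF a b eq, of v] by (simp add: deg_FO right_diff_distrib)
  then have 1: "edge_degree (a1 + F) = edge_degree (b1 + O')"
    by (intro poly_mapping_eqI) (simp add: edge_degree_add lookup_add algebra_simps flip: of_nat_eq_iff[where 'a = int])
  \<comment> \<open>Both totals gain \<open>F\<close> and \<open>O'\<close> once, so equality for
    the G2 parts follows by cancelling the G1 parts.\<close>
  have "edge_degree (a1 + F) + edge_degree (a2 + O') = edge_degree (b1 + O') + edge_degree (b2 + F)"
    using eq by (simp add: edge_degree_add add_ac)
  then have 2: "edge_degree (a2 + O') = edge_degree (b2 + F)" using 1 by simp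
  define s t where "s = Poly_Mapping.single (a1 + F) c - Poly_Mapping.single (b1 + O') c"
    and "t = Poly_Mapping.single (a2 + O') c - Poly_Mapping.single (b2 + F) c"
  have "s \<in> I" unfolding s_def
    by (rule subsetD[OF I1 binomial_in_toric_ideal])
      (use 1 a b keys_FO in \<open>simp_all add: induced_subgraph_def keys_add'\<close>)
  moreover have "t \<in> I" unfolding t_def
    by (rule subsetD[OF I2 binomial_in_toric_ideal])
      (use 2 keys2 keys_FO in \<open>simp_all add: induced_subgraph_def keys_add'\<close>)
  \<comment> \<open>The multipliers are chosen so that the mixed terms with exponent
    \<open>b1 + a2 + O'\<close> cancel.\<close>
  ultimately have "Poly_Mapping.single a2 1 * s + Poly_Mapping.single b1 1 * t \<in> I"
    using a b by (intro poly_ring_ideal_add[OF I] poly_ring_ideal_mult[OF I] single_in_poly_ring) auto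
  also have "Poly_Mapping.single a2 1 * s + Poly_Mapping.single b1 1 * t =
      Poly_Mapping.single F 1 * (Poly_Mapping.single (a1 + a2) c - Poly_Mapping.single (b1 + b2) c)"
    by (simp add: s_def t_def right_diff_distrib mult_single add_ac)
  finally show ?thesis by (auto simp: single_one_power F_def)
qed

lemma binomial_saturated:
  fixes I :: "('v set, 'k::comm_ring_1) mpoly set"
  assumes I: "ideal I (poly_ring (edges G))"
    and I1: "toric_ideal (induced_subgraph G W1) \<subseteq> I"
    and I2: "toric_ideal (induced_subgraph G W2) \<subseteq> I"
    and keys: "Poly_Mapping.keys a \<subseteq> edges G" "Poly_Mapping.keys b \<subseteq> edges G"
    and eq: "edge_degree a = edge_degree b"
  shows "\<exists>n. Poly_Mapping.single (path_part even) 1 ^ n *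
    (Poly_Mapping.single a c - Poly_Mapping.single b c) \<in> I"
proof -
  obtain a1 a2 where a: "a = a1 + a2"
    and "Poly_Mapping.keys a1 = Poly_Mapping.keys a \<inter> E1" "Poly_Mapping.keys a2 = Poly_Mapping.keys a - E1"
    by (rule poly_mapping_split_keys)
  then have a12: "Poly_Mapping.keys a1 \<subseteq> E1" "Poly_Mapping.keys a2 \<subseteq> edges G - E1" using keys by auto
  obtain b1 b2 where b: "b = b1 + b2"
    and "Poly_Mapping.keys b1 = Poly_Mapping.keys b \<inter> E1" "Poly_Mapping.keys b2 = Poly_Mapping.keys b - E1"
    by (rule poly_mapping_split_keys)
  then have b12: "Poly_Mapping.keys b1 \<subseteq> E1" "Poly_Mapping.keys b2 \<subseteq> edges G - E1" using keys by auto
  show ?thesis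
  proof (cases "deg b1 (\<phi> 1) \<le> deg a1 (\<phi> 1)")
    case True
    then show ?thesis unfolding a b
      using eq a b by (intro binomial_saturated_aux I I1 I2 a12 b12) auto
  next
    case False
    \<comment> \<open>The roles of \<open>a\<close> and \<open>b\<close> are exchanged; negating
      \<open>c\<close> leaves the binomial itself unchanged.\<close>
    have "\<exists>n. Poly_Mapping.single (path_part even) 1 ^ n *
        (Poly_Mapping.single b (- c) - Poly_Mapping.single a (- c)) \<in> I" unfolding a b
      using False eq a b by (intro binomial_saturated_aux I I1 I2 a12 b12) auto
    moreover have "Poly_Mapping.single b (- c) - Poly_Mapping.single a (- c) =
        Poly_Mapping.single a c - Poly_Mapping.single b c"
      by (simp add: single_uminus)
    ultimately show ?thesis by simp
  qed
qed

section \<open>The two inclusions between the toric ideal and the saturation\<close>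

lemma even_edge_product_eq:
  "even_edge_product l \<phi> = Poly_Mapping.single (path_part even) (1::'k::comm_ring_1)"
  unfolding even_edge_product_def mvar_def path_part_def by (rule prod_single_one)

lemma toric_ideal_subset_saturation:
  fixes I :: "('v set, 'k::comm_ring_1) mpoly set"
  assumes I: "ideal I (poly_ring (edges G))"
    and I12: "toric_ideal (induced_subgraph G W1) \<subseteq> I" "toric_ideal (induced_subgraph G W2) \<subseteq> I"
  shows "toric_ideal G \<subseteq> saturation (poly_ring (edges G)) I (even_edge_product l \<phi>)"
proof
  let ?f = "Poly_Mapping.single (path_part even) (1::'k)"
  fix p :: "('v set, 'k) mpoly" assume p: "p \<in> toric_ideal G"
  have "?f \<in> carrier (poly_ring (edges G))"
    using keys_path_part[of even] by (intro single_in_poly_ring) auto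
  then have f: "?f ^ n \<in> carrier (poly_ring (edges G))" for n by (rule poly_ring_power_closed)
  have "\<exists>n. ?f ^ n * p \<in> I" using p
  proof (induction p rule: toric_ideal_induct)
    case zero
    then show ?case using poly_ring_ideal_zero[OF I] by simp
  next
    case (add p q)
    from add.IH obtain m n where mn: "?f ^ m * p \<in> I" "?f ^ n * q \<in> I" by (elim exE)
    \<comment> \<open>Both summands are raised to the common exponent \<open>m + n\<close>.\<close>
    have "?f ^ n * (?f ^ m * p) + ?f ^ m * (?f ^ n * q) \<in> I"
      by (rule poly_ring_ideal_add[OF I poly_ring_ideal_mult[OF I mn(1) f]
            poly_ring_ideal_mult[OF I mn(2) f]])
    also have "?f ^ n * (?f ^ m * p) + ?f ^ m * (?f ^ n * q) = ?f ^ (m + n) * (p + q)"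
      unfolding power_add distrib_left by (simp only: mult_ac)
    finally show ?case by (rule exI)
  next
    case (binomial a b c)
    then show ?case by (rule binomial_saturated[OF I I12])
  qed
  then show "p \<in> saturation (poly_ring (edges G)) I (even_edge_product l \<phi>)"
    using p by (simp add: saturation_def poly_ring_nat_pow poly_ring_simps even_edge_product_eq
        toric_ideal_iff)
qed

text \<open>f is a monomial, and toric ideals are saturated with respect to monomials.\<close>

lemma saturation_subset_toric_ideal:
  fixes I :: "('v set, 'k::comm_ring_1) mpoly set"
  assumes "I \<subseteq> toric_ideal G"
  shows "saturation (poly_ring (edges G)) I (even_edge_product l \<phi>) \<subseteq> toric_ideal G"
proof
  fix p :: "('v set, 'k) mpoly"
  assume "p \<in> saturation (poly_ring (edges G)) I (even_edge_product l \<phi>)"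
  then obtain n where "p \<in> carrier (poly_ring (edges G))"
    and "Poly_Mapping.single (path_part even) 1 ^ n * p \<in> I"
    by (auto simp: saturation_def poly_ring_nat_pow poly_ring_simps even_edge_product_eq)
  then show "p \<in> toric_ideal G" using assms toric_ideal_saturated by blast
qed

theorem toric_ideal_eq_saturation:
  "(toric_ideal G :: ('v set, 'k::comm_ring_1) mpoly set) = saturation (poly_ring (edges G))
    (toric_ideal_in G (induced_subgraph G W1) <+>\<^bsub>poly_ring (edges G)\<^esub>
      toric_ideal_in G (induced_subgraph G W2)) (even_edge_product l \<phi>)"
proof -
  let ?R = "poly_ring (edges G) :: ('v set, 'k) mpoly ring"
  let ?T = "\<lambda>W. toric_ideal (induced_subgraph G W) :: ('v set, 'k) mpoly set"
  let ?J = "\<lambda>W. toric_ideal_in G (induced_subgraph G W) :: ('v set, 'k) mpoly set"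
  interpret R: cring ?R by (rule poly_ring_cring)
  have sub: "?T W \<subseteq> toric_ideal G" for W
    by (rule toric_ideal_mono) (auto simp: induced_subgraph_def)
  then have carr: "?T W \<subseteq> carrier ?R" for W using toric_ideal_iff by blast
  \<comment> \<open>An extended ideal stays inside the toric ideal of \<open>G\<close>, being the
    least ideal that contains its generators.\<close>
  have J: "ideal (?J W) ?R" "?T W \<subseteq> ?J W" "?J W \<subseteq> toric_ideal G" for W
    unfolding toric_ideal_in_def
    using R.genideal_ideal[OF carr] R.genideal_self[OF carr]
      R.genideal_minimal[OF toric_ideal_ideal[OF simple] sub] by auto
  have sum: "?J W1 <+>\<^bsub>?R\<^esub> ?J W2 = {x + y | x y. x \<in> ?J W1 \<and> y \<in> ?J W2}"
    by (auto simp: set_add_def' poly_ring_simps)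
  have zero: "0 \<in> ?J W" for W
    using poly_ring_ideal_zero[OF J(1)] .
  have "?J W1 <+>\<^bsub>?R\<^esub> ?J W2 \<subseteq> toric_ideal G"
    using J(3) poly_ring_ideal_add[OF toric_ideal_ideal[OF simple]] by (fastforce simp: sum)
  moreover have "ideal (?J W1 <+>\<^bsub>?R\<^esub> ?J W2) ?R"
    by (rule R.add_ideals[OF J(1) J(1)])
  moreover have "x + 0 \<in> ?J W1 <+>\<^bsub>?R\<^esub> ?J W2" if "x \<in> ?T W1" for x
    unfolding sum using that J(2) zero by blast
  then have "?T W1 \<subseteq> ?J W1 <+>\<^bsub>?R\<^esub> ?J W2" by auto
  moreover have "0 + x \<in> ?J W1 <+>\<^bsub>?R\<^esub> ?J W2" if "x \<in> ?T W2" for x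
    unfolding sum using that J(2) zero by blast
  then have "?T W2 \<subseteq> ?J W1 <+>\<^bsub>?R\<^esub> ?J W2" by auto
  ultimately show ?thesis
    by (intro equalityI toric_ideal_subset_saturation saturation_subset_toric_ideal)
qed

end

section \<open>From the graph-theoretic hypotheses to a path splitting\<close>

theorem theorem4p5:
  fixes G G1 G2 H :: "'v graph"
    and l :: nat
    and \<phi> :: "nat \<Rightarrow> 'v"
  assumes "finite_simple_graph G"
    and "splitting_along G G1 G2 H"
    and "l \<ge> 1"
    and "graph_iso (path_graph l) H \<phi>"
    and "\<forall>v \<in> verts H - {\<phi> 1, \<phi> (l + 1)}. vertex_degree G v = 2"
    and "bipartite G1"
  shows "(toric_ideal G :: ('v set, 'k::{alg_closed_field, field_char_0}) mpoly set) =
    saturation (poly_ring (edges G))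
      (toric_ideal_in G G1 <+>\<^bsub>poly_ring (edges G)\<^esub> toric_ideal_in G G2)
      (even_edge_product l \<phi>)"
proof -
  obtain W1 W2 where cover: "W1 \<union> W2 = verts G"
    and G1: "G1 = induced_subgraph G W1" and G2: "G2 = induced_subgraph G W2"
    and H: "H = induced_subgraph G (W1 \<inter> W2)"
    and no_cross: "\<And>u v. u \<in> W1 - (W1 \<inter> W2) \<Longrightarrow> v \<in> W2 - (W1 \<inter> W2) \<Longrightarrow> {u, v} \<notin> edges G"
    using assms(2) unfolding splitting_along_def by blast
  obtain A B where parts: "A \<union> B = W1" "A \<inter> B = {}"
    and bip: "\<And>e. e \<in> edges G \<Longrightarrow> e \<subseteq> W1 \<Longrightarrow> \<exists>a \<in> A. \<exists>b \<in> B. e = {a, b}"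
    using assms(6) by (auto simp: bipartite_def G1 induced_subgraph_def)
  have bij: "bij_betw \<phi> {1..l + 1} (W1 \<inter> W2)"
    using assms(4) by (simp add: graph_iso_def path_graph_def H induced_subgraph_def)
  have path_edge: "{\<phi> k, \<phi> (k + 1)} \<in> edges H" if k: "k \<in> {1..l}" for k
  proof -
    have "k \<in> verts (path_graph l)" "k + 1 \<in> verts (path_graph l)"
      "{k, k + 1} \<in> edges (path_graph l)"
      using k by (auto simp: path_graph_def)
    then show ?thesis using assms(4) unfolding graph_iso_def by blast
  qed
  \<comment> \<open>An inner path vertex already has two edges of \<open>H\<close>; having degree 2,
    it has no others.\<close>
  have interior: "e \<subseteq> W1 \<inter> W2" if k: "k \<in> {2..l}" and e: "e \<in> edges G" "\<phi> k \<in> e" for k e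
  proof -
    let ?N = "{e \<in> edges G. \<phi> k \<in> e}"
    let ?P = "{{\<phi> (k - 1), \<phi> k}, {\<phi> k, \<phi> (k + 1)}}"
    have inj: "\<phi> i = \<phi> j \<longleftrightarrow> i = j" if "i \<in> {1..l + 1}" "j \<in> {1..l + 1}" for i j
      using bij that by (auto simp: bij_betw_def inj_on_def)
    have "\<phi> k \<in> verts H - {\<phi> 1, \<phi> (l + 1)}"
      using k inj[of k 1] inj[of k "l + 1"] bij by (auto simp: H induced_subgraph_def bij_betw_def)
    then have N: "card ?N = 2" using assms(5) by (simp add: vertex_degree_def)
    \<comment> \<open>Since \<open>k\<close> is at least 2, the truncated subtraction is exact and
      the preceding path edge exists.\<close>
    have "k - 1 \<in> {1..l}" "k \<in> {1..l}" "k - 1 + 1 = k" using k by auto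
    then have sub: "?P \<subseteq> edges H" using path_edge[of "k - 1"] path_edge[of k] by simp
    then have "?P \<subseteq> ?N" by (auto simp: H induced_subgraph_def)
    moreover have "card ?P = 2"
    proof -
      have "k - 1 \<in> {1..l + 1}" "k \<in> {1..l + 1}" "k + 1 \<in> {1..l + 1}" using k by auto
      \<comment> \<open>The two path edges at \<open>\<phi> k\<close> are distinct because their
        other ends differ.\<close>
      then have "\<phi> (k - 1) \<noteq> \<phi> k" "\<phi> (k - 1) \<noteq> \<phi> (k + 1)" using inj k by auto
      then show ?thesis by (simp add: doubleton_eq_iff)
    qed
    \<comment> \<open>An infinite set would have \<open>card\<close> equal to 0 rather than
      2.\<close>
    moreover have "finite ?N" using N by (intro card_ge_0_finite) simp
    ultimately have "?P = ?N" using N by (intro card_subset_eq) simp_all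
    then have "e \<in> edges H" using e sub by auto
    then show ?thesis by (simp add: H induced_subgraph_def)
  qed
  interpret path_splitting G W1 W2 A B l \<phi>
  proof
    show "{\<phi> k, \<phi> (k + 1)} \<in> edges G" if "k \<in> {1..l}" for k
      using path_edge[OF that] by (simp add: H induced_subgraph_def)
    show "{u, v} \<notin> edges G" if "u \<in> W1 - W2" "v \<in> W2 - W1" for u v
      using no_cross[of u v] that by auto
  qed (fact assms(1) cover assms(3) bij interior parts bip)+
  show ?thesis unfolding G1 G2 by (rule toric_ideal_eq_saturation)
qed

end
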